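(* Let $n\ge 1$ and $d\ge 0$ be integers. Let $G=(V,E)$ be a non-empty induced subgraph of the hypercube $Q_n$ such that (1) $G$ is irreducible and (2) the minimum degree of $G$ is $\delta(G)=d$. Then the smallest possible cardinality of $V$ is $$|V|=\left\lceil 2^{d+1}-2^{2d-n}\right\rceil,$$ i.e. every such $G$ satisfies $|V|\ge \lceil 2^{d+1}-2^{2d-n}\rceil$, and (whenever such subgraphs exist for the given $n,d$) this value is attained by some such $G$.
   Context: $Q_n$ is the graph with vertex set $\{0,1\}^n$ in which two vertices are adjacent iff they differ in exactly one coordinate. Subgraphs of $Q_n$ are considered as the subgraphs induced by their vertex sets. An $m$-dimensional subcube of $Q_n$ is the induced subgraph on the set of all vertices having prescribed bit values at $n-m$ fixed distinct positions. A subgraph $G\subseteq Q_n$ is reducible if it is contained in some subgraph whose vertex set is obtained by fixing one or more of the coordinates $x_i$ to given values; otherwise it is irreducible. Equivalently, $G$ is irreducible iff every $(n-1)$-dimensional subcube of $Q_n$ (obtained by fixing a single coordinate $x_i=j$) contains at least one vertex of $G$. *)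

theory Defs
  imports Complex_Main "Graph_Theory.Graph_Theory"
begin

text \<open>
  As usual in Graph_Theory, an undirected graph is a symmetric loop-free digraph: each edge
  is a pair of opposite arcs, so the degree of a vertex is its \<^const>\<open>out_degree\<close>.
  A bit string in $\{0,1\}^n$ is a \<^typ>\<open>bool list\<close> of length $n$.
\<close>

definition hypercube :: "nat \<Rightarrow> bool list pair_pre_digraph" where
  "hypercube n =
    \<lparr> pverts = {x. length x = n},
      parcs = {(x, y). length x = n \<and> length y = n \<and> card {i. i < n \<and> x ! i \<noteq> y ! i} = 1} \<rparr>"

definition subcube_verts :: "nat \<Rightarrow> nat set \<Rightarrow> (nat \<Rightarrow> bool) \<Rightarrow> bool list set" where
  "subcube_verts n I a = {x. length x = n \<and> (\<forall>i\<in>I. x ! i = a i)}"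

definition reducible :: "nat \<Rightarrow> bool list pair_pre_digraph \<Rightarrow> bool" where
  "reducible n G \<longleftrightarrow>
    (\<exists>I a. I \<subseteq> {..<n} \<and> I \<noteq> {} \<and>
      subgraph (with_proj G) (with_proj (hypercube n) \<restriction> subcube_verts n I a))"

text \<open>Only meaningful for finite non-empty vertex sets.\<close>

definition min_degree :: "'a pair_pre_digraph \<Rightarrow> nat" where
  "min_degree G = Min (out_degree (with_proj G) ` pverts G)"

definition admissible :: "nat \<Rightarrow> nat \<Rightarrow> bool list pair_pre_digraph \<Rightarrow> bool" where
  "admissible n d G \<longleftrightarrow>
    induced_subgraph (with_proj G) (with_proj (hypercube n)) \<and> pverts G \<noteq> {} \<and>
    \<not> reducible n G \<and> min_degree G = d"

lemma pair_graph_hypercube: "pair_graph (hypercube n)"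
proof -
  have fin: "finite {x :: bool list. length x = n}"
    using finite_lists_length_eq[of "UNIV :: bool set" n] by simp
  have "parcs (hypercube n) \<subseteq> {x. length x = n} \<times> {x. length x = n}"
    by (auto simp: hypercube_def)
  with fin have "finite (parcs (hypercube n))"
    by (meson finite_SigmaI finite_subset)
  moreover have "sym (parcs (hypercube n))"
  proof (rule symI)
    fix x y assume xy: "(x, y) \<in> parcs (hypercube n)"
    have "{i. i < n \<and> y ! i \<noteq> x ! i} = {i. i < n \<and> x ! i \<noteq> y ! i}"
      by (rule Collect_cong) (simp only: eq_commute)
    then have "card {i. i < n \<and> y ! i \<noteq> x ! i} = card {i. i < n \<and> x ! i \<noteq> y ! i}"
      by (rule arg_cong)
    moreover have "length x = n" "length y = n" "card {i. i < n \<and> x ! i \<noteq> y ! i} = 1"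
      using xy unfolding hypercube_def by simp_all
    ultimately have "length y = n \<and> length x = n \<and> card {i. i < n \<and> y ! i \<noteq> x ! i} = 1"
      by (intro conjI) (assumption | erule trans)+
    then show "(y, x) \<in> parcs (hypercube n)"
      unfolding hypercube_def pair_pre_digraph.simps mem_Collect_eq case_prod_conv .
  qed
  moreover have "finite (pverts (hypercube n))"
    using fin by (simp add: hypercube_def)
  moreover have "fst e \<in> pverts (hypercube n) \<and> snd e \<in> pverts (hypercube n) \<and> fst e \<noteq> snd e"
    if "e \<in> parcs (hypercube n)" for e
  proof -
    obtain x y where e: "e = (x, y)" by (cases e)
    have "length x = n" "length y = n" "card {i. i < n \<and> x ! i \<noteq> y ! i} = 1"
      using that unfolding hypercube_def e by simp_all
    moreover from this(3) have "x \<noteq> y" by (intro notI) simp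
    ultimately show ?thesis by (simp add: e hypercube_def)
  qed
  ultimately show ?thesis
    by unfold_locales (simp_all add: symmetric_def)
qed

lemma irreducible_iff_facets:
  assumes "induced_subgraph (with_proj G) (with_proj (hypercube n))"
  shows "\<not> reducible n G \<longleftrightarrow> (\<forall>i<n. \<forall>b. \<exists>x\<in>pverts G. x ! i = b)"
proof -
  interpret Q: pair_graph "hypercube n" by (rule pair_graph_hypercube)
  have G: "pverts G \<subseteq> {x. length x = n}" "parcs G \<subseteq> parcs (hypercube n)"
      "wf_digraph (with_proj G)"
    using assms by (auto simp: induced_subgraph_def subgraph_def hypercube_def)
  have arc: "fst e \<in> pverts G \<and> snd e \<in> pverts G" if "e \<in> parcs G" for e
    using wf_digraph.tail_in_verts[OF G(3)] wf_digraph.head_in_verts[OF G(3)] that by simp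
  have wf: "wf_digraph (with_proj (hypercube n) \<restriction> S)" for S
    by unfold_locales auto
  have sub: "subgraph (with_proj G) (with_proj (hypercube n) \<restriction> subcube_verts n I a) \<longleftrightarrow>
      (\<forall>x\<in>pverts G. \<forall>i\<in>I. x ! i = a i)" for I a
  proof
    assume "subgraph (with_proj G) (with_proj (hypercube n) \<restriction> subcube_verts n I a)"
    then show "\<forall>x\<in>pverts G. \<forall>i\<in>I. x ! i = a i"
      by (auto simp: subgraph_def subcube_verts_def)
  next
    assume *: "\<forall>x\<in>pverts G. \<forall>i\<in>I. x ! i = a i"
    have "pverts G \<subseteq> subcube_verts n I a"
      using G(1) * by (auto simp: subcube_verts_def)
    moreover from this have "parcs G \<subseteq> arcs (with_proj (hypercube n) \<restriction> subcube_verts n I a)"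
      using G(2) arc by (auto simp: subset_iff)
    ultimately show "subgraph (with_proj G) (with_proj (hypercube n) \<restriction> subcube_verts n I a)"
      using G(3) wf[of "subcube_verts n I a"]
      by (simp add: subgraph_def compatible_def)
  qed
  show ?thesis
  proof
    assume irr: "\<not> reducible n G"
    show "\<forall>i<n. \<forall>b. \<exists>x\<in>pverts G. x ! i = b"
    proof (intro allI impI, rule ccontr)
      fix i b assume "i < n" "\<not> (\<exists>x\<in>pverts G. x ! i = b)"
      then have "subgraph (with_proj G)
          (with_proj (hypercube n) \<restriction> subcube_verts n {i} (\<lambda>_. \<not> b))"
        unfolding sub by auto
      moreover have "{i} \<subseteq> {..<n}" "{i} \<noteq> {}" using \<open>i < n\<close> by auto
      ultimately show False
        using irr unfolding reducible_def by blast
    qed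
  next
    assume *: "\<forall>i<n. \<forall>b. \<exists>x\<in>pverts G. x ! i = b"
    show "\<not> reducible n G"
    proof
      assume "reducible n G"
      then obtain I a i where "I \<subseteq> {..<n}" "i \<in> I" "\<forall>x\<in>pverts G. \<forall>i\<in>I. x ! i = a i"
        unfolding reducible_def sub by blast
      moreover from this have "i < n" by auto
      with * obtain x where "x \<in> pverts G" "x ! i = (\<not> a i)" by blast
      ultimately show False by auto
    qed
  qed
qed

end

theory Submission
  imports Defs
begin

text \<open>
  Put \<open>e = n - d\<close>. Every \<open>v \<in> V\<close> is \<open>sensitive\<close> in at most \<open>e\<close> coordinates, i.e. has at most
  \<open>e\<close> neighbours outside \<open>V\<close>, and in this form the lower bound says that \<open>V\<close> has density at least
  \<open>1 - (1 - p)\<^sup>2 = 2p - p\<^sup>2\<close> with \<open>p = 1/2\<^sup>e\<close>, independently of \<open>n\<close>. The basic tool is that the subcubes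
  spanned by the sensitive directions of the points of \<open>V\<close> cover the whole cube (send a point to
  a nearest point of \<open>V\<close>); it gives density \<open>p\<close>, and density \<open>2p - p\<^sup>2\<close> as soon as \<open>V\<close> contains
  a subcube of codimension \<open>e\<close>.

  Induct on the dimension. For a facet \<open>x\<^sub>i = b\<close> let \<open>k\<close> be the number of other coordinates that are
  constant on \<open>V\<close> within this facet. They are all sensitive, so induction bounds the part of
  \<open>V\<close> in the facet by \<open>p - 2\<^sup>k p\<^sup>2 / 2\<close>. Choose the facet with \<open>k\<close> maximal. If \<open>k = 0\<close>, add the bounds of
  two opposite facets; if \<open>k = e\<close>, then \<open>V\<close> contains a subcube of codimension \<open>e\<close>. Otherwise let
  \<open>x\<^sub>j = c\<close> be forced by \<open>x\<^sub>i = b\<close>. Then \<open>V\<close> is the disjoint union of its parts \<open>A\<close> in \<open>x\<^sub>i = b\<close>,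
  \<open>B\<close> in \<open>x\<^sub>j \<noteq> c\<close>, and a rest \<open>C\<close>. If \<open>C\<close> is empty, then \<open>A\<close> and \<open>B\<close> are not connected by edges and
  both have density \<open>p\<close>. If \<open>k \<le> e - 2\<close>, then \<open>A\<close> and \<open>B\<close> contribute \<open>7p/8\<close> each and
  \<open>C\<close> contributes \<open>p/4\<close>. If \<open>k = e - 1\<close>, then either \<open>A\<close> is a subcube of codimension \<open>e\<close>, or for a
  suitable \<open>j\<close> the set \<open>C\<close> is irreducible in its subcube of codimension 2, and \<open>A\<close>, \<open>B\<close>, \<open>C\<close> contribute
  \<open>3p/4\<close>, \<open>3p/4\<close> and \<open>(2p - p\<^sup>2)/4\<close>.
\<close>

section \<open>Subsets of a cube with few sensitive coordinates\<close>

definition flip :: "('a \<Rightarrow> bool) \<Rightarrow> 'a \<Rightarrow> 'a \<Rightarrow> bool" where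
  "flip v i = v(i := \<not> v i)"

text \<open>\<open>F\<close> holds the free coordinates, \<open>b\<close> prescribes the others.
  Points are functions on the whole type, so a facet is again a cube over a smaller \<open>F\<close>
  and induction needs no reindexing.\<close>

definition cube :: "'a set \<Rightarrow> ('a \<Rightarrow> bool) \<Rightarrow> ('a \<Rightarrow> bool) set" where
  "cube F b = {x. \<forall>i. i \<notin> F \<longrightarrow> x i = b i}"

text \<open>Missing neighbours are recorded instead of present ones because passing to a subcube
  never creates new ones, so a bound \<open>e\<close> is inherited.\<close>

definition sens :: "'a set \<Rightarrow> ('a \<Rightarrow> bool) set \<Rightarrow> ('a \<Rightarrow> bool) \<Rightarrow> 'a set" where
  "sens F V v = {i \<in> F. flip v i \<notin> V}"

definition spanning :: "'a set \<Rightarrow> ('a \<Rightarrow> bool) set \<Rightarrow> bool" where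
  "spanning F V \<longleftrightarrow> (\<forall>i\<in>F. \<forall>b. \<exists>v\<in>V. v i = b)"

lemma flip_same [simp]: "flip v i i = (\<not> v i)"
  and flip_other [simp]: "j \<noteq> i \<Longrightarrow> flip v i j = v j"
  and flip_flip [simp]: "flip (flip v i) i = v"
  by (auto simp: flip_def)

lemma flip_in_cube_iff: "i \<in> F \<Longrightarrow> flip v i \<in> cube F b \<longleftrightarrow> v \<in> cube F b"
  by (auto simp: cube_def flip_def)

lemma bij_betw_cube_Pow: "bij_betw (\<lambda>x. {i. x i \<noteq> b i}) (cube F b) (Pow F)"
  by (rule bij_betw_byWitness[where f' = "\<lambda>S i. (b i \<noteq> (i \<in> S))"])
    (auto simp: cube_def fun_eq_iff)

lemma card_cube: "finite F \<Longrightarrow> card (cube F b) = 2 ^ card F"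
  using bij_betw_same_card[OF bij_betw_cube_Pow[of b F]] by (simp add: card_Pow)

lemma finite_cube: "finite F \<Longrightarrow> finite (cube F b)"
  using bij_betw_finite[OF bij_betw_cube_Pow[of b F]] by simp

text \<open>Any point of the cube is reached from \<open>c\<close> by changing coordinates in
  \<open>G\<close> one at a time.\<close>

lemma cube_subset_if_flip_closed:
  assumes "finite G" "c \<in> A" and closed: "\<And>a g. a \<in> A \<Longrightarrow> g \<in> G \<Longrightarrow> flip a g \<in> A"
  shows "cube G c \<subseteq> A"
proof
  fix x assume "x \<in> cube G c"
  then have x: "(\<lambda>i. if i \<in> G then x i else c i) = x"
    by (auto simp: cube_def)
  have "(\<lambda>i. if i \<in> H then x i else c i) \<in> A" if "H \<subseteq> G" for H
    using finite_subset[OF that \<open>finite G\<close>] that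
  proof (induction H)
    case empty
    then show ?case using \<open>c \<in> A\<close> by simp
  next
    case (insert h H)
    let ?y = "\<lambda>i. if i \<in> H then x i else c i"
    let ?z = "\<lambda>i. if i \<in> insert h H then x i else c i"
    have "?y \<in> A" "h \<in> G" using insert by auto
    moreover have "?z = ?y \<or> ?z = flip ?y h"
      using insert.hyps by (cases "x h = c h") (auto simp: flip_def fun_eq_iff)
    ultimately show ?case using closed by (elim disjE) simp_all
  qed
  from this[OF subset_refl] show "x \<in> A" using x by simp
qed

text \<open>The witness is a point of \<^term>\<open>V\<close> closest to \<^term>\<open>x\<close>, among those that agree with \<^term>\<open>x\<close>
  wherever \<^term>\<open>w\<close> does.\<close>

lemma exists_local_minimum:
  assumes "finite F" "w \<in> V"
  obtains u where "u \<in> V" "\<And>i. i \<in> F \<Longrightarrow> u i \<noteq> x i \<Longrightarrow> flip u i \<notin> V"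
    "\<And>i. i \<in> F \<Longrightarrow> w i = x i \<Longrightarrow> u i = x i"
proof -
  let ?P = "\<lambda>u. u \<in> V \<and> (\<forall>i\<in>F. w i = x i \<longrightarrow> u i = x i)"
  let ?m = "\<lambda>u. card {i \<in> F. u i \<noteq> x i}"
  have "?P w" using assms by simp
  then obtain u where u: "?P u" and least: "\<And>y. ?P y \<Longrightarrow> ?m u \<le> ?m y"
    using ex_has_least_nat[of ?P w ?m] by blast
  have "flip u i \<notin> V" if i: "i \<in> F" "u i \<noteq> x i" for i
  proof
    assume "flip u i \<in> V"
    with u i have "?P (flip u i)" by (auto simp: flip_def)
    moreover have "{j \<in> F. flip u i j \<noteq> x j} \<subset> {j \<in> F. u j \<noteq> x j}"
      using i by (auto simp: flip_def)
    then have "?m (flip u i) < ?m u"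
      using \<open>finite F\<close> by (intro psubset_card_mono) auto
    ultimately show False using least by fastforce
  qed
  with u show ?thesis using that by blast
qed

section \<open>Lower bounds from coverings by sensitive subcubes\<close>

lemma card_le_covered:
  assumes F: "finite F" and V: "U \<subseteq> cube F b" and D: "D \<subseteq> cube F b"
    and s: "\<And>u. u \<in> U \<Longrightarrow> card (sens F V u) \<le> e"
    and cover: "\<And>x. x \<in> D \<Longrightarrow> \<exists>u\<in>U. \<forall>i\<in>F. u i \<noteq> x i \<longrightarrow> flip u i \<notin> V"
  shows "card D \<le> card U * 2 ^ e"
proof -
  let ?R = "\<lambda>u. cube (sens F V u) u"
  have fin: "finite (sens F V u)" for u using F by (simp add: sens_def)
  have finU: "finite U" using finite_subset[OF V finite_cube[OF F]] .
  \<comment> \<open>If all coordinates where \<open>u\<close> and \<open>x\<close> differ are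
    sensitive at \<open>u\<close>, then \<open>x\<close> lies in the subcube through
    \<open>u\<close> spanned by its sensitive directions, which has at most \<open>2 ^ e\<close>
    points.\<close>
  have "D \<subseteq> (\<Union>u\<in>U. ?R u)"
  proof
    fix x assume x: "x \<in> D"
    from cover[OF x] obtain u where u: "u \<in> U" "\<forall>i\<in>F. u i \<noteq> x i \<longrightarrow> flip u i \<notin> V" by blast
    have "x i = u i" if "i \<notin> sens F V u" for i
      using that u V D x by (cases "i \<in> F") (auto simp: sens_def cube_def subset_iff)
    with u show "x \<in> (\<Union>u\<in>U. ?R u)" by (auto simp: cube_def)
  qed
  then have "card D \<le> card (\<Union>u\<in>U. ?R u)"
    by (rule card_mono[rotated]) (use finU fin finite_cube in blast)
  also have "\<dots> \<le> (\<Sum>u\<in>U. card (?R u))" by (rule card_UN_le[OF finU])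
  also have "\<dots> \<le> (\<Sum>u\<in>U. 2 ^ e)"
    by (intro sum_mono) (use s fin in \<open>simp add: card_cube\<close>)
  finally show ?thesis by simp
qed

lemma cube_card_le:
  assumes F: "finite F" and V: "V \<subseteq> cube F b" "V \<noteq> {}"
    and s: "\<And>v. v \<in> V \<Longrightarrow> card (sens F V v) \<le> e"
  shows "2 ^ card F \<le> card V * 2 ^ e"
proof -
  obtain w where "w \<in> V" using V by blast
  then have "\<exists>u\<in>V. \<forall>i\<in>F. u i \<noteq> x i \<longrightarrow> flip u i \<notin> V" for x
    using exists_local_minimum[OF F, of w V x] by metis
  then have "card (cube F b) \<le> card V * 2 ^ e"
    by (intro card_le_covered[OF F V(1) subset_refl s]) auto
  then show ?thesis using F by (simp add: card_cube)
qed

text \<open>Points outside the subcube are covered by the points of \<open>V\<close> outside it.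
  With \<open>g = 2 ^ card G\<close> and \<open>E = 2 ^ e\<close> this gives
  \<open>card V >= g + (g * E - g) / E\<close>, which is the claim since
  \<open>2 ^ card F = g * E\<close>.\<close>

lemma bound_if_contains_subcube:
  assumes F: "finite F" and V: "V \<subseteq> cube F b" "spanning F V"
    and s: "\<And>v. v \<in> V \<Longrightarrow> card (sens F V v) \<le> e"
    and G: "G \<subseteq> F" "card F = card G + e" and Y: "cube G c \<subseteq> V"
  shows "2 ^ card F * (2 * 2 ^ e - 1) \<le> real (card V) * 4 ^ e"
proof -
  let ?Y = "cube G c"
  have finV: "finite V" using finite_subset[OF V(1) finite_cube[OF F]] .
  have finG: "finite G" using G(1) F by (rule finite_subset)
  have "\<exists>u\<in>V - ?Y. \<forall>i\<in>F. u i \<noteq> x i \<longrightarrow> flip u i \<notin> V" if x: "x \<in> cube F b - ?Y" for x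
  proof -
    have c: "c \<in> cube F b" using Y V(1) by (auto simp: cube_def)
    \<comment> \<open>A descent from some \<open>w\<close> with \<open>w j = x j\<close> keeps
      coordinate \<open>j\<close>, so the local minimum stays outside the subcube.\<close>
    from x obtain j where j: "j \<notin> G" "x j \<noteq> c j" by (auto simp: cube_def)
    with x c have "j \<in> F" by (auto simp: cube_def)
    with V(2) obtain w where w: "w \<in> V" "w j = x j" by (auto simp: spanning_def)
    obtain u where u: "u \<in> V" "\<And>i. i \<in> F \<Longrightarrow> u i \<noteq> x i \<Longrightarrow> flip u i \<notin> V"
        "\<And>i. i \<in> F \<Longrightarrow> w i = x i \<Longrightarrow> u i = x i"
      using exists_local_minimum[OF F w(1)] by blast
    have "u j \<noteq> c j" using u(3)[of j] w j \<open>j \<in> F\<close> by simp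
    with j have "u \<notin> ?Y" by (auto simp: cube_def)
    with u show ?thesis by blast
  qed
  then have "card (cube F b - ?Y) \<le> card (V - ?Y) * 2 ^ e"
    by (intro card_le_covered[OF F _ _ s]) (use V(1) in auto)
  then have "real (card (cube F b - ?Y)) \<le> real (card (V - ?Y) * 2 ^ e)"
    by (simp only: of_nat_le_iff)
  moreover have "card (cube F b - ?Y) = 2 ^ card F - 2 ^ card G"
    using Y V(1) F finG by (subst card_Diff_subset) (auto simp: card_cube finite_cube)
  moreover have "card V = 2 ^ card G + card (V - ?Y)"
    using Y finV finG card_mono[OF finV Y] by (simp add: card_Diff_subset card_cube finite_cube)
  moreover have "(2::nat) ^ card G \<le> 2 ^ card F" using G(2) by simp
  ultimately have *: "2 ^ card F - 2 ^ card G \<le> (real (card V) - 2 ^ card G) * 2 ^ e"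
    by (simp add: of_nat_diff)
  define g E where "g = (2::real) ^ card G" and "E = (2::real) ^ e"
  have [simp]: "(4::real) ^ e = E * E"
    by (simp add: E_def flip: power_mult_distrib)
  have "E > 0" by (simp add: E_def)
  from * have "g * E - g \<le> (real (card V) - g) * E"
    by (simp add: G(2) power_add g_def E_def)
  then have "(g * E - g) * E \<le> (real (card V) - g) * E * E"
    using \<open>E > 0\<close> by (intro mult_right_mono) auto
  then have "g * E * (2 * E - 1) \<le> real (card V) * (E * E)"
    by (simp add: algebra_simps)
  then show ?thesis by (simp add: G(2) power_add g_def E_def)
qed

lemma facet_card_eq_sum:
  assumes "finite V"
  shows "card V = card {v \<in> V. v i = b} + card {v \<in> V. v i = (\<not> b)}"
proof -
  have "card ({v \<in> V. v i = b} \<union> {v \<in> V. v i = (\<not> b)})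
      = card {v \<in> V. v i = b} + card {v \<in> V. v i = (\<not> b)}"
    using assms by (intro card_Un_disjoint) auto
  moreover have "{v \<in> V. v i = b} \<union> {v \<in> V. v i = (\<not> b)} = V" by auto
  ultimately show ?thesis by simp
qed

text \<open>Two coordinates determining each other split \<^term>\<open>V\<close> into two parts without edges
  between them.\<close>

lemma bound_if_linked:
  assumes F: "finite F" and V: "V \<subseteq> cube F u" "spanning F V"
    and s: "\<And>v. v \<in> V \<Longrightarrow> card (sens F V v) \<le> e"
    and ij: "i \<in> F" "i \<noteq> j" and link: "\<And>v. v \<in> V \<Longrightarrow> v i = b \<longleftrightarrow> v j = c"
  shows "2 ^ card F * (2 * 2 ^ e - 1) \<le> real (card V) * 4 ^ e"
proof -
  have half: "2 ^ card F \<le> card {v \<in> V. v i = a} * 2 ^ e" for a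
  proof (rule cube_card_le[OF F])
    show "{v \<in> V. v i = a} \<subseteq> cube F u" using V by auto
    show "{v \<in> V. v i = a} \<noteq> {}" using V(2) ij(1) by (simp add: spanning_def Bex_def)
    fix v assume v: "v \<in> {v \<in> V. v i = a}"
    \<comment> \<open>Flipping \<open>i\<close> alone would break the link and so leaves
      \<open>V\<close>; hence each half has the same sensitive coordinates as
      \<open>V\<close>.\<close>
    have "flip v g i = v i" if "flip v g \<in> V" for g
      using link[OF that] link[of v] v ij by (cases "g = i"; cases "g = j") auto
    then have "sens F {v \<in> V. v i = a} v = sens F V v"
      using v by (auto simp: sens_def)
    then show "card (sens F {v \<in> V. v i = a} v) \<le> e" using s v by simp
  qed
  have "finite V" using finite_subset[OF V(1) finite_cube[OF F]] .
  from facet_card_eq_sum[OF this, of i True] have "2 * 2 ^ card F \<le> card V * 2 ^ e"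
    using half[of True] half[of False] by (simp add: algebra_simps)
  then have "real (2 * 2 ^ card F) \<le> real (card V * 2 ^ e)" by (simp only: of_nat_le_iff)
  then have "2 * 2 ^ card F * 2 ^ e \<le> real (card V) * 2 ^ e * (2::real) ^ e"
    by (intro mult_right_mono) auto
  also have "\<dots> = real (card V) * 4 ^ e" by (simp flip: power_mult_distrib)
  finally have "2 * 2 ^ card F * 2 ^ e \<le> real (card V) * 4 ^ e" .
  moreover have "2 ^ card F * (2 * 2 ^ e - 1) \<le> 2 * 2 ^ card F * (2::real) ^ e"
    by (simp add: algebra_simps)
  ultimately show ?thesis by linarith
qed

section \<open>Forced coordinates and the density bound\<close>

definition forced :: "'a set \<Rightarrow> ('a \<Rightarrow> bool) set \<Rightarrow> 'a \<Rightarrow> bool \<Rightarrow> 'a set" where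
  "forced F V i b = {j \<in> F - {i}. \<exists>c. \<forall>v\<in>V. v i = b \<longrightarrow> v j = c}"

lemma forced_subset_sens:
  assumes "v \<in> V" "v i = b"
  shows "forced F V i b \<subseteq> sens F V v"
proof
  fix j assume "j \<in> forced F V i b"
  then obtain c where j: "j \<in> F" "j \<noteq> i" and c: "\<forall>v\<in>V. v i = b \<longrightarrow> v j = c"
    by (auto simp: forced_def)
  have "flip v j \<notin> V"
  proof
    assume "flip v j \<in> V"
    then have "flip v j j = c" using c j assms by auto
    moreover have "v j = c" using c assms by auto
    ultimately show False by simp
  qed
  with j show "j \<in> sens F V v" by (simp add: sens_def)
qed

lemma forced_agree:
  assumes "j \<in> forced F V i b" "v \<in> V" "v i = b" "w \<in> V" "w i = b"
  shows "v j = w j"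
proof -
  obtain c where "\<forall>v\<in>V. v i = b \<longrightarrow> v j = c" using assms(1) unfolding forced_def by blast
  with assms(2-5) show ?thesis by metis
qed

text \<open>This is density \<open>2p - p^2\<close> for \<open>p = 1 / 2 ^ e\<close>, cleared of
  denominators. The bound \<open>e\<close> varies in the induction: on a facet that forces
  \<open>k\<close> coordinates it drops to \<open>e - k\<close>.\<close>

theorem card_spanning_ge:
  assumes "finite F" "V \<subseteq> cube F u" "V \<noteq> {}" "spanning F V"
    and "\<And>v. v \<in> V \<Longrightarrow> card (sens F V v) \<le> e"
  shows "2 ^ card F * (2 * 2 ^ e - 1) \<le> real (card V) * 4 ^ e"
  using assms
proof (induction "card F" arbitrary: F V u e rule: less_induct)
  case less
  note F = less.prems(1) and V = less.prems(2-4) and s = less.prems(5)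
  have finV: "finite V" using finite_subset[OF V(1) finite_cube[OF F]] .
  define N E where "N = (2::real) ^ card F" and "E = (2::real) ^ e"
  have pos: "N > 0" "E \<ge> 1" by (simp_all add: N_def E_def)
  have E2: "(4::real) ^ e = E * E" by (simp add: E_def flip: power_mult_distrib)
  let ?k = "\<lambda>i b. card (forced F V i b)"
  let ?facet = "\<lambda>i b. {v \<in> V. v i = b}"
  have finJ: "finite (forced F V i b)" for i b using F by (simp add: forced_def)
  have fins: "finite (sens F V v)" for v using F by (simp add: sens_def)
  have ne: "?facet i b \<noteq> {}" if "i \<in> F" for i b
    using V(3) that by (simp add: spanning_def Bex_def)
  have k_le: "?k i b \<le> e" if i: "i \<in> F" for i b
  proof -
    obtain v where v: "v \<in> V" "v i = b" using ne[OF i] by blast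
    have "?k i b \<le> card (sens F V v)"
      by (rule card_mono[OF fins forced_subset_sens[OF v]])
    with s[OF v(1)] show ?thesis by linarith
  qed
  have cardF: "card F = card (F - {i} - forced F V i b) + ?k i b + 1" if "i \<in> F" for i b
  proof -
    have "forced F V i b \<subseteq> F - {i}" by (auto simp: forced_def)
    then have "card (F - {i}) = card (F - {i} - forced F V i b) + ?k i b"
      using F finJ card_mono[of "F - {i}" "forced F V i b"] by (simp add: card_Diff_subset)
    moreover have "card F = card (F - {i}) + 1"
      using card.remove[OF F that] by simp
    ultimately show ?thesis by simp
  qed
  have facet_cube: "?facet i b \<subseteq> cube (F - {i} - forced F V i b) w"
    if w: "w \<in> V" "w i = b" for i b w
  proof
    fix v assume "v \<in> ?facet i b"
    then have v: "v \<in> V" "v i = b" by auto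
    have "v j = w j" if "j \<notin> F - {i} - forced F V i b" for j
    proof (cases "j \<in> F")
      case False
      then show ?thesis using v w V(1) by (auto simp: cube_def)
    next
      case True
      with that have "j = i \<or> j \<in> forced F V i b" by blast
      then show ?thesis using forced_agree[OF _ v w] v w by metis
    qed
    then show "v \<in> cube (F - {i} - forced F V i b) w" by (simp add: cube_def)
  qed
  \<comment> \<open>Removing \<open>i\<close> and the forced coordinates from \<open>F\<close> makes
    the facet spanning. The forced coordinates are sensitive at each of its points, so the induction
    hypothesis applies with \<open>e - ?k i b\<close>.\<close>
  have facet: "N * (E - 2 ^ ?k i b / 2) \<le> real (card (?facet i b)) * (E * E)"
    if i: "i \<in> F" for i b
  proof -
    let ?A = "?facet i b" and ?G = "F - {i} - forced F V i b"
    obtain w where w: "w \<in> V" "w i = b" using ne[OF i] by blast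
    have "spanning ?G ?A"
      unfolding spanning_def
    proof (intro ballI allI)
      fix j c assume j: "j \<in> ?G"
      then have "\<not> (\<forall>v\<in>V. v i = b \<longrightarrow> v j = (\<not> c))" by (auto simp: forced_def)
      then show "\<exists>v\<in>?A. v j = c" by auto
    qed
    moreover have "card (sens ?G ?A v) \<le> e - ?k i b" if "v \<in> ?A" for v
    proof -
      have "sens ?G ?A v \<union> forced F V i b \<subseteq> sens F V v"
        using that forced_subset_sens[of v V i b F] by (auto simp: sens_def)
      from card_mono[OF fins this] s[of v] that
      have "card (sens ?G ?A v \<union> forced F V i b) \<le> e" by auto
      moreover have "sens ?G ?A v \<inter> forced F V i b = {}" by (auto simp: sens_def)
      then have "card (sens ?G ?A v \<union> forced F V i b) = card (sens ?G ?A v) + ?k i b"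
        using F finJ by (intro card_Un_disjoint) (auto simp: sens_def)
      ultimately show ?thesis by simp
    qed
    moreover have "card ?G < card F" using cardF[OF i, of b] by simp
    ultimately have IH: "2 ^ card ?G * (2 * 2 ^ (e - ?k i b) - 1) \<le> real (card ?A) * 4 ^ (e - ?k i b)"
      using F facet_cube[OF w] w by (intro less.hyps) auto
    define g K D where "g = (2::real) ^ card ?G" and "K = (2::real) ^ ?k i b"
      and "D = (2::real) ^ (e - ?k i b)"
    have "4 ^ (e - ?k i b) = D * D" by (simp add: D_def flip: power_mult_distrib)
    with IH have "g * (2 * D - 1) \<le> real (card ?A) * (D * D)" by (simp add: g_def D_def)
    then have "g * (2 * D - 1) * (K * K) \<le> real (card ?A) * (D * D) * (K * K)"
      by (rule mult_right_mono) (simp add: K_def)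
    moreover have E: "E = D * K"
      using k_le[OF i, of b] by (simp add: E_def D_def K_def flip: power_add)
    have N: "N = 2 * g * K"
      by (subst N_def, subst cardF[OF i, of b]) (simp add: g_def K_def power_add)
    have "g * (2 * D - 1) * (K * K) = N * (E - K / 2)"
      by (simp add: E N field_simps)
    moreover have "real (card ?A) * (D * D) * (K * K) = real (card ?A) * (E * E)"
      by (simp add: E)
    ultimately show ?thesis unfolding K_def by (simp only:)
  qed
  show ?case
  proof (cases "F = {}")
    case True
    have "card V > 0" using V(2) finV by (simp add: card_gt_0_iff)
    then have "real (card V) \<ge> 1" by linarith
    then have "E * E \<le> real (card V) * (E * E)"
      using pos mult_right_mono[of 1 "real (card V)" "E * E"] by simp
    moreover have "0 \<le> (E - 1) * (E - 1)" by simp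
    then have "2 * E - 1 \<le> E * E" by (simp add: algebra_simps)
    ultimately show ?thesis using True by (simp add: E2 flip: E_def)
  next
    case False
    let ?L = "F \<times> (UNIV :: bool set)"
    have "finite ((\<lambda>(i, b). ?k i b) ` ?L)" "(\<lambda>(i, b). ?k i b) ` ?L \<noteq> {}"
      using F False by auto
    from Max_in[OF this] obtain i b where i: "i \<in> F"
      and eq: "Max ((\<lambda>(i, b). ?k i b) ` ?L) = ?k i b" by auto
    have k_max: "?k j c \<le> ?k i b" if "j \<in> F" for j c
    proof -
      have "?k j c \<in> (\<lambda>(i, b). ?k i b) ` ?L" using that by force
      then show ?thesis unfolding eq[symmetric] using F by (intro Max_ge) auto
    qed
    define k where "k = ?k i b"
    let ?A = "?facet i b" and ?J = "forced F V i b"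
    let ?G = "F - {i} - ?J"
    obtain w where w: "w \<in> V" "w i = b" using ne[OF i] by blast
    have subcube: "cube G c \<subseteq> V \<Longrightarrow> G \<subseteq> F \<Longrightarrow> card F = card G + e \<Longrightarrow> ?thesis" for G c
      by (rule bound_if_contains_subcube[OF F V(1,3) s])
    have finG: "finite ?G" using F by simp
    consider "k = 0" | "k = e" "k > 0" | "k > 0" "k < e" using k_le[OF i, of b] k_def by linarith
    then show ?thesis
    proof cases
      case 1
      \<comment> \<open>By maximality the opposite facet forces nothing either; twice
        \<open>p - p^2 / 2\<close> is exactly the bound.\<close>
      then have "?k i b = 0" "?k i (\<not> b) = 0" using k_max[OF i, of "\<not> b"] k_def by auto
      then have "N * (E - 1 / 2) \<le> real (card (?facet i b)) * (E * E)"
        "N * (E - 1 / 2) \<le> real (card (?facet i (\<not> b))) * (E * E)"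
        using facet[OF i, of b] facet[OF i, of "\<not> b"] by simp_all
      then have "N * (2 * E - 1) \<le> (real (card (?facet i b)) + real (card (?facet i (\<not> b)))) * (E * E)"
        by (simp add: algebra_simps)
      then show ?thesis using facet_card_eq_sum[OF finV, of i b] by (simp add: E2 N_def E_def)
    next
      case 2
      \<comment> \<open>On \<open>?A\<close> the \<open>e\<close> forced coordinates exhaust the
        sensitive ones. So \<open>?A\<close> is a full subcube, and crossing direction
        \<open>i\<close> doubles it to codimension \<open>e\<close>.\<close>
      have sJ: "sens F V v = ?J" if "v \<in> ?A" for v
        using card_subset_eq[OF fins, of ?J v] forced_subset_sens[of v V i b F]
          card_mono[OF fins, of ?J v] s[of v] 2 k_def that by auto
      have iJ: "i \<notin> ?J" by (simp add: forced_def)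
      have A: "cube ?G w \<subseteq> ?A"
      proof (rule cube_subset_if_flip_closed[OF finG])
        fix a g assume a: "a \<in> ?A" and g: "g \<in> ?G"
        then have "g \<notin> sens F V a" using sJ by auto
        with a g show "flip a g \<in> ?A" by (auto simp: sens_def)
      qed (use w in auto)
      have "cube (F - ?J) w \<subseteq> V"
      proof
        fix x assume x: "x \<in> cube (F - ?J) w"
        show "x \<in> V"
        proof (cases "x i = b")
          case True
          then have "x \<in> cube ?G w" using x w by (auto simp: cube_def)
          then show ?thesis using A by auto
        next
          case False
          then have "flip x i \<in> cube ?G w" using x w i by (auto simp: cube_def flip_def)
          then have "flip x i \<in> ?A" using A by auto
          then have "i \<notin> sens F V (flip x i)" using sJ iJ by auto
          then show ?thesis using i by (simp add: sens_def)
        qed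
      qed
      moreover have "card F = card (F - ?J) + e"
      proof -
        have "?J \<subseteq> F" by (auto simp: forced_def)
        then show ?thesis
          using finJ card_mono[OF F, of ?J] 2 k_def by (simp add: card_Diff_subset)
      qed
      ultimately show ?thesis by (intro subcube) auto
    next
      case 3
      have Jne: "?J \<noteq> {}" using 3 k_def by auto
      have Jw: "v j = w j" if "j \<in> ?J" "v \<in> V" "v i = b" for v j
        by (rule forced_agree[OF that w])
      \<comment> \<open>The value forced on \<open>j\<close> is \<open>w j\<close>. Choosing the
        smallest opposite facet lets an inclusion between two such facets become an equality when
        \<open>k = e - 1\<close>.\<close>
      obtain j where j: "j \<in> ?J"
        and j_min: "\<And>l. l \<in> ?J \<Longrightarrow> card (?facet j (\<not> w j)) \<le> card (?facet l (\<not> w l))"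
        using Jne ex_has_least_nat[of "\<lambda>l. l \<in> ?J" _ "\<lambda>l. card (?facet l (\<not> w l))"]
        by blast
      have jF: "j \<in> F" "j \<noteq> i" using j by (auto simp: forced_def)
      let ?B = "?facet j (\<not> w j)"
      define C where "C = {v \<in> V. v i = (\<not> b) \<and> v j = w j}"
      have linked: ?thesis if "p \<in> F" "p \<noteq> q" "\<And>v. v \<in> V \<Longrightarrow> v p = x \<longleftrightarrow> v q = y" for p q x y
        by (rule bound_if_linked[OF F V(1,3) s that])
      have cardV: "card V = card ?A + card ?B + card C"
      proof -
        have "V = ?A \<union> ?B \<union> C" using Jw[OF j] by (auto simp: C_def)
        moreover have "card (?A \<union> ?B \<union> C) = card ?A + card ?B + card C"
        proof -
          have "card (?A \<union> ?B \<union> C) = card (?A \<union> ?B) + card C"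
            using finV by (intro card_Un_disjoint) (auto simp: C_def)
          moreover have "card (?A \<union> ?B) = card ?A + card ?B"
            using finV Jw[OF j] by (intro card_Un_disjoint) auto
          ultimately show ?thesis by simp
        qed
        ultimately show ?thesis by simp
      qed
      show ?thesis
      proof (cases "C = {}")
        case True
        then show ?thesis
          using Jw[OF j] i jF by (intro linked[of i j b "w j"]) (auto simp: C_def)
      next
        case Cne: False
        let ?H = "F - {i} - {j}"
        have cardH: "card F = card ?H + 2"
        proof -
          have "j \<in> F - {i}" "finite (F - {i})" using F jF by auto
          from card.remove[OF this(2,1)] card.remove[OF F i] show ?thesis by simp
        qed
        have N4: "N = 4 * 2 ^ card ?H" by (simp add: N_def cardH)
        have C_cube: "C \<subseteq> cube ?H (u(i := \<not> b, j := w j))"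
          using V(1) by (auto simp: C_def cube_def)
        have C_sens: "card (sens ?H C v) \<le> e" if "v \<in> C" for v
        proof -
          have "sens ?H C v \<subseteq> sens F V v" using that by (auto simp: sens_def C_def)
          from card_mono[OF fins this] s[of v] that show ?thesis by (auto simp: C_def)
        qed
        have A_ge: "N * (E - 2 ^ k / 2) \<le> real (card ?A) * (E * E)"
          using facet[OF i, of b] by (simp add: k_def)
        \<comment> \<open>By maximality the facet \<open>?B\<close> forces at most \<open>k\<close>
          coordinates, so it obeys the same bound as \<open>?A\<close>.\<close>
        have "N * (E - 2 ^ k / 2) \<le> N * (E - 2 ^ ?k j (\<not> w j) / 2)"
          using k_max[OF jF(1), of "\<not> w j"] pos by (simp add: k_def)
        then have B_ge: "N * (E - 2 ^ k / 2) \<le> real (card ?B) * (E * E)"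
          using facet[OF jF(1), of "\<not> w j"] by linarith
        show ?thesis
        proof (cases "k + 1 = e")
          case False
          have "2 ^ card ?H \<le> card C * 2 ^ e"
            by (rule cube_card_le[OF _ C_cube Cne C_sens]) (use F in auto)
          then have "real (2 ^ card ?H) \<le> real (card C * 2 ^ e)" by (simp only: of_nat_le_iff)
          then have "N / 4 * E \<le> real (card C) * E * E"
            using pos by (intro mult_right_mono) (auto simp: N4 E_def)
          \<comment> \<open>Here \<open>k + 2 \<le> e\<close>, so the loss \<open>2 ^ k / 2\<close>
            is at most \<open>E / 8\<close>; the three parts then reach density
            \<open>2p\<close>.\<close>
          moreover have "E \<ge> 4 * 2 ^ k"
          proof -
            have "(2::real) ^ (k + 2) \<le> 2 ^ e" using 3 False by (intro power_increasing) auto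
            then show ?thesis by (simp add: E_def)
          qed
          then have "N * (E * (7 / 8)) \<le> N * (E - 2 ^ k / 2)"
            using pos by (intro mult_left_mono) auto
          ultimately have "N * (2 * E) \<le> (real (card ?A) + real (card ?B) + real (card C)) * (E * E)"
            using A_ge B_ge by (simp add: algebra_simps)
          moreover have "N * (2 * E - 1) \<le> N * (2 * E)" using pos by simp
          ultimately have "N * (2 * E - 1) \<le> (real (card ?A) + real (card ?B) + real (card C)) * (E * E)"
            by linarith
          then show ?thesis by (simp add: E2 cardV N_def E_def)
        next
          case ke: True
          show ?thesis
          proof (cases "cube ?G w \<subseteq> V")
            case True
            then show ?thesis
              using cardF[OF i, of b] ke by (intro subcube[of ?G w]) (auto simp: k_def)
          next
            case not_full: False
            \<comment> \<open>Otherwise the points of \<open>?A\<close> with value \<open>c\<close>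
              at \<open>z\<close> have exactly \<open>i\<close> and \<open>?J\<close> as sensitive
              coordinates, so flips in \<open>?G\<close> keep them in \<open>?A\<close>. They fill
              half of \<open>cube ?G w\<close>, and flipping \<open>z\<close> fills the other half,
              against \<open>not_full\<close>.\<close>
            have partner: "\<exists>a\<in>?A. a z = c \<and> flip a i \<in> V" if z: "z \<in> ?G" for z c
            proof (rule ccontr)
              assume none: "\<not> ?thesis"
              let ?D = "{a \<in> ?A. a z = c}"
              have closed: "flip a g \<in> ?A" if a: "a \<in> ?D" and g: "g \<in> ?G" for a g
              proof -
                have "insert i ?J \<subseteq> sens F V a"
                  using a none i forced_subset_sens[of a V i b F] by (auto simp: sens_def)
                moreover have "card (insert i ?J) = e"
                  using ke finJ by (simp add: k_def forced_def)
                ultimately have "insert i ?J = sens F V a"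
                  using s[of a] a card_mono[OF fins, of "insert i ?J" a]
                  by (intro card_subset_eq[OF fins]) auto
                then have "g \<notin> sens F V a" using g by blast
                with a g show ?thesis by (auto simp: sens_def)
              qed
              have "\<not> (\<forall>v\<in>V. v i = b \<longrightarrow> v z = (\<not> c))"
                using z by (auto simp: forced_def)
              then obtain a where a: "a \<in> ?D" by auto
              have D: "cube (?G - {z}) a \<subseteq> ?D"
                using closed finG by (intro cube_subset_if_flip_closed[OF _ a]) auto
              have "x \<in> V" if x: "x \<in> cube ?G w" for x
              proof -
                have xa: "x q = a q" if "q \<notin> ?G" for q
                  using x facet_cube[OF w] a that by (auto simp: cube_def)
                show ?thesis
                proof (cases "x z = c")
                  case True
                  then have "x \<in> cube (?G - {z}) a" using xa a by (auto simp: cube_def)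
                  then show ?thesis using D by auto
                next
                  case False
                  then have "flip x z \<in> cube (?G - {z}) a"
                    using xa a z by (auto simp: cube_def flip_def)
                  then have "flip (flip x z) z \<in> ?A" using D closed z by blast
                  then show ?thesis by simp
                qed
              qed
              with not_full show False by blast
            qed
            have in_C: "flip a i \<in> C" if "a \<in> ?A" "flip a i \<in> V" for a
              using that Jw[OF j] jF by (auto simp: C_def)
            show ?thesis
            proof (cases "\<exists>l\<in>?J. l \<noteq> j \<and> ?facet l (\<not> w l) \<subseteq> ?B")
              case True
              then obtain l where l: "l \<in> ?J" "l \<noteq> j" "?facet l (\<not> w l) \<subseteq> ?B" by blast
              \<comment> \<open>Minimality of \<open>?B\<close> turns the inclusion into equality,
                so \<open>j\<close> and \<open>l\<close> determine each other on
                \<open>V\<close>.\<close>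
              have "?facet l (\<not> w l) = ?B"
                using l finV j_min[OF l(1)] by (intro card_seteq) auto
              then have "v j = (\<not> w j) \<longleftrightarrow> v l = (\<not> w l)" if "v \<in> V" for v
                using that by blast
              then show ?thesis by (rule linked[OF jF(1) l(2)[symmetric]])
            next
              case no_link: False
              \<comment> \<open>Coordinates in \<open>?G\<close> take both values at partners moved
                across \<open>i\<close>. A forced \<open>l\<close> takes \<open>w l\<close> at any
                partner, and the opposite value at a point outside \<open>?B\<close>, which is not
                in \<open>?A\<close> because \<open>l\<close> is forced there.\<close>
              have "spanning ?H C"
                unfolding spanning_def
              proof (intro ballI allI)
                fix l c assume l: "l \<in> ?H"
                show "\<exists>v\<in>C. v l = c"
                proof (cases "l \<in> ?J")
                  case False
                  then have "l \<in> ?G" using l by auto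
                  from partner[OF this] obtain a where "a \<in> ?A" "a l = c" "flip a i \<in> V" by blast
                  then show ?thesis using in_C l by (intro bexI[of _ "flip a i"]) auto
                next
                  case True
                  show ?thesis
                  proof (cases "c = w l")
                    case c: True
                    have "?G \<noteq> {}"
                    proof
                      assume "?G = {}"
                      then have "cube ?G w \<subseteq> {w}" by (auto simp: cube_def)
                      with not_full w show False by blast
                    qed
                    then obtain z where "z \<in> ?G" by blast
                    from partner[OF this] obtain a where a: "a \<in> ?A" "flip a i \<in> V" by blast
                    then have "a l = c" using Jw[OF True] c by auto
                    then show ?thesis using in_C[OF a] l by (intro bexI[of _ "flip a i"]) auto
                  next
                    case c: False
                    obtain v where v: "v \<in> V" "v l = (\<not> w l)" "v j = w j"
                      using no_link True l by blast
                    then have "v i = (\<not> b)" using Jw[OF True] by blast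
                    with v c show ?thesis by (intro bexI[of _ v]) (auto simp: C_def)
                  qed
                qed
              qed
              then have "2 ^ card ?H * (2 * 2 ^ e - 1) \<le> real (card C) * 4 ^ e"
                using C_cube Cne C_sens F cardH by (intro less.hyps) auto
              then have "N / 4 * (2 * E - 1) \<le> real (card C) * (E * E)"
                by (simp add: N4 E2 E_def)
              \<comment> \<open>Since \<open>E = 2 * 2 ^ k\<close>, both facets lose a quarter of
                \<open>E\<close>. Only a quarter of the term \<open>p^2\<close> remains in the sum,
                coming from \<open>C\<close>.\<close>
              moreover have "E - 2 ^ k / 2 = E * (3 / 4)" by (simp add: E_def flip: ke)
              note A_ge[unfolded this] B_ge[unfolded this]
              ultimately have "N * (2 * E - 1 / 4) \<le> (real (card ?A) + real (card ?B) + real (card C)) * (E * E)"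
                by (simp add: algebra_simps)
              moreover have "N * (2 * E - 1) \<le> N * (2 * E - 1 / 4)" using pos by simp
              ultimately have "N * (2 * E - 1) \<le> (real (card ?A) + real (card ?B) + real (card C)) * (E * E)"
                by linarith
              then show ?thesis by (simp add: E2 cardV N_def E_def)
            qed
          qed
        qed
      qed
    qed
  qed
qed

section \<open>Bit strings and the extremal example\<close>

text \<open>Padding with \<open>False\<close> from \<open>n\<close> on identifies bit strings of
  length \<open>n\<close> with the points of \<open>cube {..<n} (\<lambda>_. False)\<close>.\<close>

definition bits :: "nat \<Rightarrow> bool list \<Rightarrow> nat \<Rightarrow> bool" where
  "bits n x = (\<lambda>i. i < n \<and> x ! i)"

lemma inj_on_bits: "inj_on (bits n) {x. length x = n}"
proof (rule inj_onI)
  fix x y :: "bool list"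
  assume "x \<in> {x. length x = n}" "y \<in> {x. length x = n}" "bits n x = bits n y"
  then show "x = y"
    by (intro nth_equalityI) (auto simp: bits_def fun_eq_iff)
qed

lemma bits_map: "w \<in> cube {..<n} (\<lambda>_. False) \<Longrightarrow> bits n (map w [0..<n]) = w"
proof
  fix i assume "w \<in> cube {..<n} (\<lambda>_. False)"
  then show "bits n (map w [0..<n]) i = w i"
    by (cases "i < n") (auto simp: bits_def cube_def)
qed

lemma bits_in_cube: "bits n x \<in> cube {..<n} (\<lambda>_. False)"
  by (auto simp: bits_def cube_def)

lemma flip_bits: "length x = n \<Longrightarrow> i < n \<Longrightarrow> flip (bits n x) i = bits n (x[i := \<not> x ! i])"
  by (auto simp: bits_def flip_def fun_eq_iff nth_list_update)

lemma hypercube_arc_iff: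
  "(x, y) \<in> parcs (hypercube n) \<longleftrightarrow> length x = n \<and> (\<exists>i<n. y = x[i := \<not> x ! i])"
proof
  assume "(x, y) \<in> parcs (hypercube n)"
  then have len: "length x = n" "length y = n" and "card {i. i < n \<and> x ! i \<noteq> y ! i} = 1"
    by (simp_all add: hypercube_def)
  then obtain i where i: "{i. i < n \<and> x ! i \<noteq> y ! i} = {i}" by (auto simp: card_1_singleton_iff)
  then have "i < n" "x ! i \<noteq> y ! i" by auto
  moreover have "x ! j = y ! j" if "j < n" "j \<noteq> i" for j using i that by auto
  ultimately have "y = x[i := \<not> x ! i]"
    using len by (intro nth_equalityI) (auto simp: nth_list_update)
  with len \<open>i < n\<close> show "length x = n \<and> (\<exists>i<n. y = x[i := \<not> x ! i])" by blast
next
  assume "length x = n \<and> (\<exists>i<n. y = x[i := \<not> x ! i])"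
  then obtain i where "length x = n" "i < n" "y = x[i := \<not> x ! i]" by blast
  moreover from this have "{j. j < n \<and> x ! j \<noteq> y ! j} = {i}"
    by (auto simp: nth_list_update split: if_splits)
  ultimately show "(x, y) \<in> parcs (hypercube n)" by (simp add: hypercube_def)
qed

lemma out_degree_eq:
  assumes "induced_subgraph (with_proj G) (with_proj (hypercube n))" "x \<in> pverts G"
  shows "out_degree (with_proj G) x
    = card {i \<in> {..<n}. flip (bits n x) i \<in> bits n ` pverts G}"
proof -
  have V: "pverts G \<subseteq> {x. length x = n}"
    using assms(1) by (auto simp: induced_subgraph_def subgraph_def hypercube_def)
  then have len: "length x = n" using assms(2) by auto
  have arcs: "parcs G = {e \<in> parcs (hypercube n). fst e \<in> pverts G \<and> snd e \<in> pverts G}"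
    using assms(1) by (simp add: induced_subgraph_def)
  let ?I = "{i \<in> {..<n}. flip (bits n x) i \<in> bits n ` pverts G}"
  let ?f = "\<lambda>i. (x, x[i := \<not> x ! i])"
  have I: "?I = {i \<in> {..<n}. x[i := \<not> x ! i] \<in> pverts G}"
  proof (rule Collect_cong, rule conj_cong[OF refl])
    fix i assume "i \<in> {..<n}"
    then show "flip (bits n x) i \<in> bits n ` pverts G \<longleftrightarrow> x[i := \<not> x ! i] \<in> pverts G"
      using len inj_on_image_mem_iff[OF inj_on_bits _ V, of "x[i := \<not> x ! i]"]
      by (simp add: flip_bits)
  qed
  have "out_arcs (with_proj G) x = ?f ` ?I"
    unfolding I using assms(2) len
    by (auto simp: out_arcs_def arcs hypercube_arc_iff)
  moreover have "inj_on ?f ?I"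
  proof (rule inj_onI)
    fix i j assume ij: "i \<in> ?I" "j \<in> ?I" "?f i = ?f j"
    then have eq: "x[i := \<not> x ! i] ! i = x[j := \<not> x ! j] ! i" by simp
    show "i = j"
    proof (rule ccontr)
      assume "i \<noteq> j"
      with eq ij(1) len show False by simp
    qed
  qed
  ultimately show ?thesis by (simp add: out_degree_def card_image)
qed

lemma admissibleD:
  assumes "admissible n d G"
  defines "W \<equiv> bits n ` pverts G"
  shows "card W = card (pverts G)" "W \<subseteq> cube {..<n} (\<lambda>_. False)" "W \<noteq> {}" "spanning {..<n} W"
    "\<forall>w\<in>W. d \<le> card {i \<in> {..<n}. flip w i \<in> W}"
    "\<exists>w\<in>W. card {i \<in> {..<n}. flip w i \<in> W} = d"
proof -
  have ind: "induced_subgraph (with_proj G) (with_proj (hypercube n))"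
    and ne: "pverts G \<noteq> {}" and irr: "\<not> reducible n G" and deg: "min_degree G = d"
    using assms by (auto simp: admissible_def)
  have V: "pverts G \<subseteq> {x. length x = n}"
    using ind by (auto simp: induced_subgraph_def subgraph_def hypercube_def)
  show "card W = card (pverts G)"
    unfolding W_def using inj_on_subset[OF inj_on_bits V] by (rule card_image)
  show "W \<subseteq> cube {..<n} (\<lambda>_. False)" "W \<noteq> {}"
    using ne bits_in_cube by (auto simp: W_def)
  show "spanning {..<n} W"
    using irr[unfolded irreducible_iff_facets[OF ind]] by (auto simp: spanning_def W_def bits_def)
  have fin: "finite (pverts G)"
    using finite_subset[OF V] finite_lists_length_eq[of "UNIV :: bool set" n] by simp
  have *: "out_degree (with_proj G) x = card {i \<in> {..<n}. flip (bits n x) i \<in> W}"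
    if "x \<in> pverts G" for x
    unfolding W_def by (rule out_degree_eq[OF ind that])
  show "\<forall>w\<in>W. d \<le> card {i \<in> {..<n}. flip w i \<in> W}"
    using fin * deg[symmetric] by (auto simp: min_degree_def W_def)
  have "d \<in> out_degree (with_proj G) ` pverts G"
    unfolding deg[symmetric] min_degree_def using fin ne by (intro Min_in) auto
  then obtain x where "x \<in> pverts G" "out_degree (with_proj G) x = d" by auto
  then show "\<exists>w\<in>W. card {i \<in> {..<n}. flip w i \<in> W} = d"
    using * by (intro bexI[of _ "bits n x"]) (auto simp: W_def)
qed

text \<open>Allows the extremal example to be built and checked as a set of functions; the graph is
  the one induced on the corresponding bit strings.\<close>

lemma admissible_of_cube_subset:
  assumes W: "W \<subseteq> cube {..<n} (\<lambda>_. False)" "spanning {..<n} W"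
    and ge: "\<And>w. w \<in> W \<Longrightarrow> d \<le> card {i \<in> {..<n}. flip w i \<in> W}"
    and ex: "\<exists>w\<in>W. card {i \<in> {..<n}. flip w i \<in> W} = d"
  shows "\<exists>G. admissible n d G \<and> card (pverts G) = card W"
proof -
  define S where "S = {x. length x = n \<and> bits n x \<in> W}"
  define G where "G = \<lparr>pverts = S, parcs = {e \<in> parcs (hypercube n). fst e \<in> S \<and> snd e \<in> S}\<rparr>"
  have bW: "bits n ` S = W"
  proof
    show "bits n ` S \<subseteq> W" by (auto simp: S_def)
    show "W \<subseteq> bits n ` S"
    proof
      fix w assume "w \<in> W"
      with W(1) bits_map[of w n] show "w \<in> bits n ` S"
        by (intro image_eqI[of _ _ "map w [0..<n]"]) (auto simp: S_def)
    qed
  qed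
  interpret Q: pair_graph "hypercube n" by (rule pair_graph_hypercube)
  have ind: "induced_subgraph (with_proj G) (with_proj (hypercube n))"
  proof -
    have "wf_digraph (with_proj G)" by unfold_locales (auto simp: G_def)
    then show ?thesis
      using Q.wf_digraph
      by (auto simp: induced_subgraph_def subgraph_def compatible_def G_def S_def)
        (simp add: hypercube_def)
  qed
  have S: "S \<subseteq> {x. length x = n}" by (auto simp: S_def)
  have fin: "finite S"
    using finite_subset[OF S] finite_lists_length_eq[of "UNIV :: bool set" n] by simp
  have "S \<noteq> {}" using bW ex by auto
  have deg: "out_degree (with_proj G) x = card {i \<in> {..<n}. flip (bits n x) i \<in> W}"
    if "x \<in> S" for x
    using out_degree_eq[OF ind, of x] that bW by (simp add: G_def)
  have "min_degree G = d"
    unfolding min_degree_def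
  proof (rule Min_eqI)
    show "finite (out_degree (with_proj G) ` pverts G)" using fin by (simp add: G_def)
    show "d \<le> y" if "y \<in> out_degree (with_proj G) ` pverts G" for y
      using that ge deg by (auto simp: G_def S_def)
    obtain w where w: "w \<in> W" "card {i \<in> {..<n}. flip w i \<in> W} = d" using ex by blast
    then obtain x where "x \<in> S" "w = bits n x" using bW by blast
    then show "d \<in> out_degree (with_proj G) ` pverts G"
      using deg[of x] w by (auto simp: G_def intro!: image_eqI[of _ _ x])
  qed
  moreover have "\<not> reducible n G"
    unfolding irreducible_iff_facets[OF ind]
  proof (intro allI impI)
    fix i b assume i: "i < n"
    then obtain w where "w \<in> W" "w i = b" using W(2) unfolding spanning_def by blast
    then obtain x where "x \<in> S" "bits n x i = b" using bW by blast
    then show "\<exists>x\<in>pverts G. x ! i = b" using i by (auto simp: G_def bits_def)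
  qed
  ultimately have "admissible n d G"
    using ind \<open>S \<noteq> {}\<close> by (simp add: admissible_def G_def)
  moreover have "card (pverts G) = card W"
    using card_image[OF inj_on_subset[OF inj_on_bits S]] bW by (simp add: G_def)
  ultimately show ?thesis by blast
qed

text \<open>The extremal example is a union of two \<open>d\<close>-dimensional subcubes, one fixing the first
  \<open>n - d\<close> coordinates to 0 and the other the last \<open>n - d\<close> coordinates to 1.\<close>

lemma two_subcubes:
  assumes "d \<le> n" "\<not> (n = 1 \<and> d = 0)"
  defines "W \<equiv> cube {n - d..<n} (\<lambda>_. False) \<union> cube {..<d} (\<lambda>i. i < n)"
  shows "W \<subseteq> cube {..<n} (\<lambda>_. False)" "spanning {..<n} W"
    "\<And>w. w \<in> W \<Longrightarrow> d \<le> card {i \<in> {..<n}. flip w i \<in> W}"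
    "\<exists>w\<in>W. card {i \<in> {..<n}. flip w i \<in> W} = d"
    "real (card W) = 2 ^ (d + 1) - (if n \<le> 2 * d then 2 ^ (2 * d - n) else 0)"
proof -
  let ?X = "cube {n - d..<n} (\<lambda>_. False)" and ?Y = "cube {..<d} (\<lambda>i. i < n)"
  show "W \<subseteq> cube {..<n} (\<lambda>_. False)"
    using \<open>d \<le> n\<close> by (auto simp: W_def cube_def)
  have zero: "(\<lambda>_. False) \<in> W" and one: "(\<lambda>i. i < n) \<in> W"
    by (auto simp: W_def cube_def)
  show "spanning {..<n} W"
    unfolding spanning_def
  proof (intro ballI allI)
    fix i b assume "i \<in> {..<n}"
    then show "\<exists>v\<in>W. v i = b" using bexI[OF _ zero] bexI[OF _ one] by (cases b) auto
  qed
  show ge: "d \<le> card {i \<in> {..<n}. flip w i \<in> W}" if "w \<in> W" for w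
  proof -
    from that consider "w \<in> ?X" | "w \<in> ?Y" by (auto simp: W_def)
    then show ?thesis
    proof cases
      case 1
      then have "{n - d..<n} \<subseteq> {i \<in> {..<n}. flip w i \<in> W}"
        by (auto simp: W_def flip_in_cube_iff)
      from card_mono[OF _ this] show ?thesis using \<open>d \<le> n\<close> by simp
    next
      case 2
      then have "{..<d} \<subseteq> {i \<in> {..<n}. flip w i \<in> W}"
        using \<open>d \<le> n\<close> by (auto simp: W_def flip_in_cube_iff)
      from card_mono[OF _ this] show ?thesis by simp
    qed
  qed
  \<comment> \<open>The zero vertex has degree exactly \<open>d\<close>: a neighbour in a direction
    \<open>i < n - d\<close> lies outside \<open>?X\<close>, and it lies in \<open>?Y\<close> only
    if \<open>d = i = n - 1\<close>, which forces \<open>n = 1\<close> and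
    \<open>d = 0\<close>.\<close>
  have "{i \<in> {..<n}. flip (\<lambda>_. False) i \<in> W} \<subseteq> {n - d..<n}"
  proof (rule subsetI, rule ccontr)
    fix i assume i: "i \<in> {i \<in> {..<n}. flip (\<lambda>_. False) i \<in> W}" "i \<notin> {n - d..<n}"
    then have lt: "i < n - d" "i < n" by auto
    have "flip (\<lambda>_. False) i \<notin> ?X"
      using lt by (auto simp: cube_def intro!: exI[of _ i])
    with i have "flip (\<lambda>_. False) i \<in> ?Y" by (auto simp: W_def)
    then have *: "j = i" if "d \<le> j" "j < n" for j
      using that by (auto simp: cube_def flip_def split: if_splits)
    from *[of d] *[of "n - 1"] lt have "d = i" "n - 1 = i" by auto
    with lt assms(2) show False by auto
  qed
  from card_mono[OF _ this] have "card {i \<in> {..<n}. flip (\<lambda>_. False) i \<in> W} \<le> d"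
    using \<open>d \<le> n\<close> by simp
  with ge[OF zero] zero show "\<exists>w\<in>W. card {i \<in> {..<n}. flip w i \<in> W} = d"
    using le_antisym by blast
  \<comment> \<open>For \<open>n \<le> 2 * d\<close> the free ranges overlap in
    \<open>{n - d..<d}\<close>; otherwise coordinate \<open>d\<close> is fixed to 0 in
    \<open>?X\<close> and to 1 in \<open>?Y\<close>.\<close>
  have inter: "card (?X \<inter> ?Y) = (if n \<le> 2 * d then 2 ^ (2 * d - n) else 0)"
  proof (cases "n \<le> 2 * d")
    case True
    have "?X \<inter> ?Y = cube {n - d..<d} (\<lambda>i. d \<le> i \<and> i < n)" (is "_ = ?Z")
    proof (intro set_eqI iffI)
      fix x assume "x \<in> ?X \<inter> ?Y"
      then have X: "\<And>i. i \<notin> {n - d..<n} \<Longrightarrow> \<not> x i" and Y: "\<And>i. i \<notin> {..<d} \<Longrightarrow> x i = (i < n)"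
        by (auto simp: cube_def)
      have "x i = (d \<le> i \<and> i < n)" if "i \<notin> {n - d..<d}" for i
        using X[of i] Y[of i] that by (cases "i < d") auto
      then show "x \<in> ?Z" by (simp add: cube_def)
    next
      fix x assume "x \<in> ?Z"
      then have Z: "\<And>i. i \<notin> {n - d..<d} \<Longrightarrow> x i = (d \<le> i \<and> i < n)" by (auto simp: cube_def)
      have "\<not> x i" if "i \<notin> {n - d..<n}" for i using Z[of i] that True \<open>d \<le> n\<close> by auto
      moreover have "x i = (i < n)" if "i \<notin> {..<d}" for i using Z[of i] that by auto
      ultimately show "x \<in> ?X \<inter> ?Y" by (simp add: cube_def)
    qed
    moreover have "d - (n - d) = 2 * d - n" using True \<open>d \<le> n\<close> by simp
    ultimately show ?thesis using True by (simp add: card_cube)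
  next
    case False
    have "x d = False" "x d = True" if "x \<in> ?X \<inter> ?Y" for x
      using that False by (auto simp: cube_def)
    then have "?X \<inter> ?Y = {}" by blast
    then show ?thesis using False by simp
  qed
  have "card W + card (?X \<inter> ?Y) = card ?X + card ?Y"
    unfolding W_def by (rule card_Un_Int[symmetric]) (simp_all add: finite_cube)
  then have "card W + card (?X \<inter> ?Y) = 2 ^ (d + 1)"
    using \<open>d \<le> n\<close> by (simp add: card_cube)
  then have "real (card W) + real (card (?X \<inter> ?Y)) = 2 ^ (d + 1)"
    by (metis of_nat_add of_nat_numeral of_nat_power)
  then show "real (card W) = 2 ^ (d + 1) - (if n \<le> 2 * d then 2 ^ (2 * d - n) else 0)"
    unfolding inter by (simp split: if_splits)
qed

section \<open>Rounding and the final statement\<close>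

lemma ceiling_bound_eq:
  "\<lceil>(2::real) ^ (d + 1) - 2 powi (2 * int d - int n)\<rceil>
    = 2 ^ (d + 1) - (if n \<le> 2 * d then 2 ^ (2 * d - n) else 0)"
proof (cases "n \<le> 2 * d")
  case True
  then have "2 * int d - int n = int (2 * d - n)" by simp
  then have "(2::real) powi (2 * int d - int n) = 2 ^ (2 * d - n)"
    by (simp only: power_int_of_nat)
  then have "(2::real) ^ (d + 1) - 2 powi (2 * int d - int n)
      = of_int (2 ^ (d + 1) - 2 ^ (2 * d - n))" by simp
  then show ?thesis using True by (simp only: ceiling_of_int if_True)
next
  \<comment> \<open>The subtracted power lies strictly between 0 and 1, so rounding up removes it;
    this is the case of disjoint subcubes.\<close>
  case False
  define m where "m = n - 2 * d"
  have "2 * int d - int n = - int m" "m > 0" using False by (auto simp: m_def)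
  then have "(2::real) powi (2 * int d - int n) = 1 / 2 ^ m"
    by (simp only: power_int_minus power_int_of_nat inverse_eq_divide)
  moreover have "(2::real) ^ m > 1" using \<open>m > 0\<close> by simp
  ultimately have "0 < (2::real) powi (2 * int d - int n)" "(2::real) powi (2 * int d - int n) < 1"
    by simp_all
  then have "\<lceil>(2::real) ^ (d + 1) - 2 powi (2 * int d - int n)\<rceil> = 2 ^ (d + 1)"
    by (intro ceiling_unique) auto
  then show ?thesis using False by simp
qed

theorem theorem2:
  fixes n d :: nat
  assumes "n \<ge> 1"
  shows "(\<forall>G. admissible n d G \<longrightarrow>
            int (card (pverts G)) \<ge> \<lceil>(2::real) ^ (d + 1) - 2 powi (2 * int d - int n)\<rceil>) \<and>
         ((\<exists>G. admissible n d G) \<longrightarrow>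
            (\<exists>G. admissible n d G \<and>
              int (card (pverts G)) = \<lceil>(2::real) ^ (d + 1) - 2 powi (2 * int d - int n)\<rceil>))"
proof (intro conjI allI impI)
  have d_le: "d \<le> n" if G: "admissible n d G" for G
  proof -
    obtain w where "card {i \<in> {..<n}. flip w i \<in> bits n ` pverts G} = d"
      using admissibleD(6)[OF G] by blast
    then show ?thesis
      using card_mono[of "{..<n}" "{i \<in> {..<n}. flip w i \<in> bits n ` pverts G}"] by auto
  qed
  {
    fix G assume G: "admissible n d G"
    let ?W = "bits n ` pverts G"
    note W = admissibleD[OF G]
    have "d \<le> n" by (rule d_le[OF G])
    have "card (sens {..<n} ?W w) \<le> n - d" if "w \<in> ?W" for w
    proof -
      have "sens {..<n} ?W w = {..<n} - {i \<in> {..<n}. flip w i \<in> ?W}"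
        by (auto simp: sens_def)
      then have "card (sens {..<n} ?W w) = n - card {i \<in> {..<n}. flip w i \<in> ?W}"
        using card_Diff_subset[of "{i \<in> {..<n}. flip w i \<in> ?W}" "{..<n}"] by auto
      moreover have "d \<le> card {i \<in> {..<n}. flip w i \<in> ?W}" by (rule bspec[OF W(5) that])
      ultimately show ?thesis by linarith
    qed
    \<comment> \<open>The density bound with \<open>e = n - d\<close>; dividing by
      \<open>4 ^ (n - d)\<close> turns its left side into
      \<open>2 ^ (d + 1) - 2 ^ d / 2 ^ (n - d)\<close>.\<close>
    then have "2 ^ n * (2 * 2 ^ (n - d) - 1) \<le> real (card (pverts G)) * 4 ^ (n - d)"
      using card_spanning_ge[OF _ W(2-4), of "n - d"] W(1) by simp
    moreover have "(4::real) ^ (n - d) = 2 ^ (n - d) * 2 ^ (n - d)"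
      by (simp flip: power_mult_distrib)
    moreover have n: "(2::real) ^ n = 2 ^ d * 2 ^ (n - d)"
      using \<open>d \<le> n\<close> by (simp flip: power_add)
    ultimately have "2 ^ d * (2 * 2 ^ (n - d) - 1) \<le> real (card (pverts G)) * 2 ^ (n - d)"
      by simp
    then have "2 * 2 ^ d - 2 ^ d / 2 ^ (n - d) \<le> real (card (pverts G))"
      by (simp add: field_simps)
    moreover have "2 * int d - int n = int d - int (n - d)" using \<open>d \<le> n\<close> by simp
    then have "(2::real) powi (2 * int d - int n) = 2 ^ d / 2 ^ (n - d)"
      using power_int_diff[of "2::real" "int d" "int (n - d)"]
      by (simp only: power_int_of_nat) simp
    ultimately show "int (card (pverts G)) \<ge> \<lceil>(2::real) ^ (d + 1) - 2 powi (2 * int d - int n)\<rceil>"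
      by (simp add: ceiling_le_iff)
  next
    assume "\<exists>G. admissible n d G"
    then obtain G where G: "admissible n d G" by blast
    note W = admissibleD[OF G]
    \<comment> \<open>The two subcubes fail only here: irreducibility puts both vertices of the
      one-dimensional cube into \<open>G\<close>, so no vertex has degree 0.\<close>
    have "\<not> (n = 1 \<and> d = 0)"
    proof
      assume nd: "n = 1 \<and> d = 0"
      then obtain w where w: "w \<in> bits n ` pverts G" "flip w 0 \<notin> bits n ` pverts G"
        using W(6) by auto
      obtain v where v: "v \<in> bits n ` pverts G" "v 0 = (\<not> w 0)"
        using W(4) nd unfolding spanning_def by blast
      have "v = flip w 0"
      proof
        fix i show "v i = flip w 0 i"
          using v w(1) W(2) nd by (cases i) (auto simp: cube_def bits_def)
      qed
      with v w show False by simp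
    qed
    note two = two_subcubes[OF d_le[OF G] this]
    from admissible_of_cube_subset[OF two(1-4)] two(5) obtain H where
      "admissible n d H"
      and "real (card (pverts H)) = 2 ^ (d + 1) - (if n \<le> 2 * d then 2 ^ (2 * d - n) else 0)"
      by metis
    then have "real_of_int (int (card (pverts H)))
        = real_of_int (2 ^ (d + 1) - (if n \<le> 2 * d then 2 ^ (2 * d - n) else 0))" by simp
    then have "int (card (pverts H)) = 2 ^ (d + 1) - (if n \<le> 2 * d then 2 ^ (2 * d - n) else 0)"
      by (simp only: of_int_eq_iff)
    with \<open>admissible n d H\<close>
    show "\<exists>G. admissible n d G \<and>
        int (card (pverts G)) = \<lceil>(2::real) ^ (d + 1) - 2 powi (2 * int d - int n)\<rceil>"
      unfolding ceiling_bound_eq by blast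
  }
qed

end
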